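(* Let $f\colon X\to X$ be a first-time sensitive homeomorphism of a compact connected metric space $(X,d)$ satisfying (P1) and (P2), and let $\varepsilon$, $(r_k)_k$, $(m_\gamma)_{\gamma\in(0,\varepsilon]}$ and $\mathcal F^u_\gamma$ be as fixed in the context. If $\gamma\in(0,\varepsilon]$ and $C\in\mathcal F^u_\gamma$, then there exists $\ell_\gamma\in\{0,1,\ldots,2m_\gamma\}$ such that $\operatorname{diam}(f^{\ell_\gamma}(C))\geq\varepsilon$.
   Context: $B(x,r)$ denotes the open ball. (P1): there exists $r>0$ such that $B(x,r')$ is connected for every $r'\in(0,r)$ and every $x\in X$. (P2): the map $(x,s)\mapsto\overline{B(x,s)}$ is continuous in the Hausdorff topology. A map $f$ is sensitive with sensitivity constant $\varepsilon>0$ if for every $x\in X$ and $\delta>0$ there exist $y\in X$ with $d(x,y)<\delta$ and $n\in\mathbb N$ with $d(f^n(x),f^n(y))>\varepsilon$. Any smaller positive number is then also a sensitivity constant. The first increasing time $n_1(x,r,\gamma)$, for a sensitivity constant $\gamma$, is the first iterate $n\ge0$ with $\operatorname{diam}f^n(B(x,r))>\gamma$. A sensitive homeomorphism $f$ with sensitivity constant $\varepsilon$ is first-time sensitive if there is a sequence of functions $r_k\colon X\to(0,\infty)$, $k\in\mathbb N=\{1,2,\dots\}$, with $r_1$ constant and $(r_k(x))_k$ decreasing monotonically to $0$ for each $x$, such that for each $\gamma\in(0,\varepsilon]$ there is $m_\gamma>0$ satisfying (F1) $|n_1(x,r_{k+1}(x),\gamma)-n_1(x,r_k(x),\gamma)|\leq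 m_\gamma$ and (F2) $|n_1(x,r_k(x),\gamma)-n_1(x,r_k(x),\varepsilon)|\leq m_\gamma$ for every $x\in X$ and every $k$ with $r_k(x)\leq\gamma$. Fixed data: $f$ is first-time sensitive with a sensitivity constant $c$; $r\in(0,c)$ is such that all balls of radius less than $r$ are connected, and $\varepsilon\in(0,r)$ is fixed (first-time sensitivity then also holds with $\varepsilon$ in place of $c$). Functions $(r_k)_k$ and positive integers $m_\gamma$, $\gamma\in(0,\varepsilon]$, as in the definition of first-time sensitivity for $\varepsilon$ are fixed. For $\gamma\in(0,\varepsilon]$, $\mathcal F^u_\gamma$ is the set of all Hausdorff limits $C=\lim_{k\to\infty}f^{n_k}\big(\overline{B(f^{-n_k}(x),r_{n_k})}\big)$, where $x\in X$, $n_k\to\infty$ are positive integers, $r_{n_k}\to0$ are radii of the form $r_{n_k}=r_{j_k}(f^{-n_k}(x))$ with $j_k\in\mathbb N$, and $n_1(f^{-n_k}(x),r_{n_k},\gamma)\in(n_k,n_k+m_\gamma]$ for every $k$. *)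

theory Defs
  imports "HOL-Analysis.Analysis"
begin

(* The metric space X is the universe of a type of class metric_space; compactness and
   connectedness are stated as assumptions on UNIV.  Sequences indexed by {1,2,...} are
   functions on nat whose value at 0 is unconstrained and never used. *)

(* Meaningful only for nonempty bounded sets: otherwise infdist and SUP are default values. *)
definition hausdorff_dist :: "'a::metric_space set \<Rightarrow> 'a set \<Rightarrow> real" where
  "hausdorff_dist A B = max (SUP a\<in>A. infdist a B) (SUP b\<in>B. infdist b A)"

(* Convergence in the hyperspace of nonempty compact sets. *)
definition hausdorff_limit :: "(nat \<Rightarrow> 'a::metric_space set) \<Rightarrow> 'a set \<Rightarrow> bool" where
  "hausdorff_limit A C \<longleftrightarrow>
     (\<forall>k. compact (A k) \<and> A k \<noteq> {}) \<and> compact C \<and> C \<noteq> {} \<and>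
     (\<lambda>k. hausdorff_dist (A k) C) \<longlonglongrightarrow> 0"

definition P1 :: "'a::metric_space itself \<Rightarrow> bool" where
  "P1 _ \<longleftrightarrow> (\<exists>r>0. \<forall>r'. 0 < r' \<and> r' < r \<longrightarrow> (\<forall>x::'a. connected (ball x r')))"

(* Joint continuity on X \<times> (0,\<infinity>).  The closure of an open ball may differ from cball. *)
definition P2 :: "'a::metric_space itself \<Rightarrow> bool" where
  "P2 _ \<longleftrightarrow> (\<forall>(x::'a) s. s > 0 \<longrightarrow>
     ((\<lambda>(y, t). hausdorff_dist (closure (ball y t)) (closure (ball x s))) \<longlongrightarrow> 0)
       (at (x, s) within UNIV \<times> {0<..}))"

definition sensitive :: "('a::metric_space \<Rightarrow> 'a) \<Rightarrow> real \<Rightarrow> bool" where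
  "sensitive f \<epsilon> \<longleftrightarrow> \<epsilon> > 0 \<and>
     (\<forall>x. \<forall>\<delta>>0. \<exists>y. dist x y < \<delta> \<and> (\<exists>n\<ge>1. dist ((f ^^ n) x) ((f ^^ n) y) > \<epsilon>))"

(* If \<gamma> is a sensitivity constant and r > 0, such an iterate exists. *)
definition n1 :: "('a::metric_space \<Rightarrow> 'a) \<Rightarrow> 'a \<Rightarrow> real \<Rightarrow> real \<Rightarrow> nat" where
  "n1 f x r \<gamma> = (LEAST n. diameter ((f ^^ n) ` ball x r) > \<gamma>)"

(* The functions \<rho> k (k \<ge> 1) and the numbers m \<gamma> have the properties required
   in the definition of first-time sensitivity for the constant \<epsilon>. *)
definition first_time_data ::
  "('a::metric_space \<Rightarrow> 'a) \<Rightarrow> real \<Rightarrow> (nat \<Rightarrow> 'a \<Rightarrow> real) \<Rightarrow> (real \<Rightarrow> real) \<Rightarrow> bool" where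
  "first_time_data f \<epsilon> \<rho> m \<longleftrightarrow>
     (\<forall>k\<ge>1. \<forall>x. \<rho> k x > 0) \<and>
     (\<exists>a. \<forall>x. \<rho> 1 x = a) \<and>
     (\<forall>x. (\<forall>k\<ge>1. \<rho> (Suc k) x \<le> \<rho> k x) \<and> (\<lambda>k. \<rho> k x) \<longlonglongrightarrow> 0) \<and>
     (\<forall>\<gamma>. 0 < \<gamma> \<and> \<gamma> \<le> \<epsilon> \<longrightarrow> m \<gamma> > 0 \<and>
       (\<forall>x. \<forall>k\<ge>1. \<rho> k x \<le> \<gamma> \<longrightarrow>
          \<bar>real (n1 f x (\<rho> (Suc k) x) \<gamma>) - real (n1 f x (\<rho> k x) \<gamma>)\<bar> \<le> m \<gamma> \<and>
          \<bar>real (n1 f x (\<rho> k x) \<gamma>) - real (n1 f x (\<rho> k x) \<epsilon>)\<bar> \<le> m \<gamma>))"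

definition first_time_sensitive :: "('a::metric_space \<Rightarrow> 'a) \<Rightarrow> real \<Rightarrow> bool" where
  "first_time_sensitive f \<epsilon> \<longleftrightarrow>
     homeomorphism UNIV UNIV f (inv f) \<and> sensitive f \<epsilon> \<and> (\<exists>\<rho> m. first_time_data f \<epsilon> \<rho> m)"

definition Fu ::
  "('a::metric_space \<Rightarrow> 'a) \<Rightarrow> (nat \<Rightarrow> 'a \<Rightarrow> real) \<Rightarrow> (real \<Rightarrow> nat) \<Rightarrow> real \<Rightarrow> 'a set set" where
  "Fu f \<rho> m \<gamma> = {C. \<exists>x (n :: nat \<Rightarrow> nat) (j :: nat \<Rightarrow> nat).
     (\<forall>k. n k \<ge> 1 \<and> j k \<ge> 1) \<and>
     filterlim n at_top sequentially \<and>
     (\<lambda>k. \<rho> (j k) ((inv f ^^ n k) x)) \<longlonglongrightarrow> 0 \<and>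
     (\<forall>k. n1 f ((inv f ^^ n k) x) (\<rho> (j k) ((inv f ^^ n k) x)) \<gamma> \<in> {n k <.. n k + m \<gamma>}) \<and>
     hausdorff_limit
       (\<lambda>k. (f ^^ n k) ` closure (ball ((inv f ^^ n k) x) (\<rho> (j k) ((inv f ^^ n k) x)))) C}"

end

theory Submission
  imports Defs
begin

text \<open>
  Write \<open>A\<^sub>k = f\<^bsup>n\<^sub>k\<^esup>(closure B\<^sub>k)\<close> for the sets whose Hausdorff limit is \<open>C\<close>.  The iterate
  \<open>f\<^bsup>n\<^sub>k\<^esup>\<close> is taken at most \<open>m \<gamma>\<close> steps before the ball \<open>B\<^sub>k\<close> first becomes larger than \<open>\<gamma>\<close>.
  Once the radius is below \<open>\<gamma>\<close>, condition (F2) says that the ball becomes larger than \<open>\<epsilon>\<close> at a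
  time differing from that one by at most \<open>m \<gamma>\<close>, and it cannot happen earlier because
  \<open>\<gamma> \<le> \<epsilon>\<close>.  So some \<open>f\<^bsup>l\<^esup>(A\<^sub>k)\<close> with \<open>l \<le> 2 m \<gamma>\<close> has diameter exceeding \<open>\<epsilon>\<close>
  (\<open>n1_diameter\<close> and \<open>n1_mono\<close>).

  The exponent \<open>l\<close> depends on \<open>k\<close>, but ranges over a finite set.  If all the sets
  \<open>f\<^bsup>l\<^esup>(C)\<close> with \<open>l \<le> 2 m \<gamma>\<close> had diameter below \<open>\<epsilon>\<close>, then upper semicontinuity of the
  diameter under Hausdorff limits (\<open>hausdorff_limit_diameter_less\<close>) would give one \<open>k\<close> for which
  all the sets \<open>f\<^bsup>l\<^esup>(A\<^sub>k)\<close> have diameter below \<open>\<epsilon>\<close>, a contradiction.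
\<close>

lemma infdist_le_hausdorff_dist:
  fixes A C :: "'a::metric_space set"
  assumes "compact A" and "a \<in> A"
  shows "infdist a C \<le> hausdorff_dist A C"
proof -
  have "compact ((\<lambda>a. infdist a C) ` A)"
    by (intro compact_continuous_image continuous_intros assms)
  then have "bdd_above ((\<lambda>a. infdist a C) ` A)"
    by (intro bounded_imp_bdd_above compact_imp_bounded)
  then have "infdist a C \<le> (SUP a\<in>A. infdist a C)"
    using assms(2) by (rule cSUP_upper2) simp
  then show ?thesis
    by (simp add: hausdorff_dist_def)
qed

text \<open>
  Any two points of \<open>A k\<close> are close to two points of \<open>C\<close>, and uniform continuity makes their
  images close too, so the diameter of \<open>g ` A k\<close> exceeds that of \<open>g ` C\<close> by arbitrarily little.
\<close>

lemma hausdorff_limit_diameter_less: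
  fixes A :: "nat \<Rightarrow> 'a::metric_space set" and g :: "'a \<Rightarrow> 'b::metric_space"
  assumes lim: "hausdorff_limit A C"
    and g: "uniformly_continuous_on UNIV g"
    and less: "diameter (g ` C) < e"
  shows "\<forall>\<^sub>F k in sequentially. diameter (g ` A k) < e"
proof -
  have A: "compact (A k)" "A k \<noteq> {}" for k
    using lim by (auto simp: hausdorff_limit_def)
  have C: "compact C" "C \<noteq> {}"
    using lim by (auto simp: hausdorff_limit_def)
  have "compact (g ` C)"
    using g C by (meson compact_continuous_image continuous_on_subset subset_UNIV
        uniformly_continuous_imp_continuous)
  then have bdd: "bounded (g ` C)"
    by (rule compact_imp_bounded)
  define \<eta> where "\<eta> = (e - diameter (g ` C)) / 3"
  have "\<eta> > 0"
    using less by (simp add: \<eta>_def)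
  then obtain \<delta> where "\<delta> > 0" and \<delta>: "\<And>a b. dist a b < \<delta> \<Longrightarrow> dist (g a) (g b) < \<eta>"
    using g unfolding uniformly_continuous_on_def by (metis UNIV_I)
  have "\<forall>\<^sub>F k in sequentially. hausdorff_dist (A k) C < \<delta>"
    using lim \<open>\<delta> > 0\<close> by (auto simp: hausdorff_limit_def intro: order_tendstoD(2))
  then show ?thesis
  proof eventually_elim
    case (elim k)
    have near: "\<exists>c\<in>C. dist (g a) (g c) < \<eta>" if "a \<in> A k" for a
    proof -
      have "bdd_below ((\<lambda>c. dist a c) ` C)"
        by (rule bdd_belowI2[of _ 0]) simp
      moreover have "(INF c\<in>C. dist a c) < \<delta>"
        using infdist_le_hausdorff_dist[OF A(1) that, of C] elim \<open>C \<noteq> {}\<close>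
        by (simp add: infdist_def)
      ultimately show ?thesis
        using cINF_less_iff[OF \<open>C \<noteq> {}\<close>] \<delta> by blast
    qed
    have "dist (g a) (g b) \<le> diameter (g ` C) + 2 * \<eta>" if ab: "a \<in> A k" "b \<in> A k" for a b
    proof -
      obtain a' b' where "a' \<in> C" "b' \<in> C"
        and d: "dist (g a) (g a') < \<eta>" "dist (g b) (g b') < \<eta>"
        using near ab by meson
      then have "dist (g a') (g b') \<le> diameter (g ` C)"
        by (intro diameter_bounded_bound[OF bdd]) auto
      moreover have "dist (g a) (g b) \<le> dist (g a) (g a') + dist (g a') (g b') + dist (g b) (g b')"
        by metric
      ultimately show ?thesis
        using d by linarith
    qed
    then have "diameter (g ` A k) \<le> diameter (g ` C) + 2 * \<eta>"
      unfolding diameter_def[of "g ` A k"] using A(2)[of k] by (auto intro!: cSUP_least)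
    also have "\<dots> < e"
      using less by (simp add: \<eta>_def field_simps)
    finally show ?case .
  qed
qed

text \<open>Sensitivity makes every ball grow beyond the constant, so the least such time is attained.\<close>

lemma n1_diameter:
  fixes f :: "'a::metric_space \<Rightarrow> 'a"
  assumes bdd: "bounded (UNIV :: 'a set)"
    and sens: "sensitive f c" and "\<epsilon> \<le> c" and "s > 0"
  shows "diameter ((f ^^ n1 f x s \<epsilon>) ` ball x s) > \<epsilon>"
proof -
  obtain y n where "dist x y < s" and far: "dist ((f ^^ n) x) ((f ^^ n) y) > c"
    using sens \<open>s > 0\<close> unfolding sensitive_def by blast
  then have "dist ((f ^^ n) x) ((f ^^ n) y) \<le> diameter ((f ^^ n) ` ball x s)"
    using \<open>s > 0\<close>
    by (intro diameter_bounded_bound bounded_subset[OF bdd]) auto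
  with far \<open>\<epsilon> \<le> c\<close> have "diameter ((f ^^ n) ` ball x s) > \<epsilon>"
    by linarith
  then show ?thesis
    unfolding n1_def by (rule LeastI)
qed

lemma n1_mono:
  fixes f :: "'a::metric_space \<Rightarrow> 'a"
  assumes "bounded (UNIV :: 'a set)"
    and "sensitive f c" and "\<epsilon> \<le> c" and "s > 0" and "\<gamma> \<le> \<epsilon>"
  shows "n1 f x s \<gamma> \<le> n1 f x s \<epsilon>"
  using n1_diameter[OF assms(1-4), of x] \<open>\<gamma> \<le> \<epsilon>\<close>
  unfolding n1_def[of f x s \<gamma>] by (intro Least_le) simp

theorem proposition2p5:
  fixes f :: "'a::metric_space \<Rightarrow> 'a"
    and c r \<epsilon> \<gamma> :: real
    and \<rho> :: "nat \<Rightarrow> 'a \<Rightarrow> real"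
    and m :: "real \<Rightarrow> nat"
    and C :: "'a set"
  assumes "compact (UNIV :: 'a set)" and "connected (UNIV :: 'a set)"
    and "P1 TYPE('a)" and "P2 TYPE('a)"
    and "first_time_sensitive f c"
    and "0 < r" and "r < c"
    and "\<forall>s<r. \<forall>x::'a. connected (ball x s)"
    and "0 < \<epsilon>" and "\<epsilon> < r"
    and "first_time_data f \<epsilon> \<rho> (\<lambda>\<gamma>'. real (m \<gamma>'))"
    and "0 < \<gamma>" and "\<gamma> \<le> \<epsilon>"
    and "C \<in> Fu f \<rho> m \<gamma>"
  shows "\<exists>l\<in>{0..2 * m \<gamma>}. diameter ((f ^^ l) ` C) \<ge> \<epsilon>"
proof (rule ccontr)
  assume "\<not> ?thesis"
  then have small: "diameter ((f ^^ l) ` C) < \<epsilon>" if "l \<in> {0..2 * m \<gamma>}" for l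
    using that by force
  have bdd: "bounded (UNIV :: 'a set)"
    using assms(1) by (rule compact_imp_bounded)
  have sens: "sensitive f c" and "continuous_on UNIV f"
    using assms(5) by (auto simp: first_time_sensitive_def homeomorphism_def)
  then have "continuous_on UNIV (f ^^ l)" for l
    by (induction l) (auto intro: continuous_on_compose continuous_on_subset
        simp del: o_apply simp: id_def)
  then have ucont: "uniformly_continuous_on UNIV (f ^^ l)" for l
    using assms(1) by (rule compact_uniformly_continuous)
  have "\<epsilon> \<le> c"
    using \<open>\<epsilon> < r\<close> \<open>r < c\<close> by simp
  obtain x and n j :: "nat \<Rightarrow> nat" where j: "\<And>k. j k \<ge> 1"
    and radii: "(\<lambda>k. \<rho> (j k) ((inv f ^^ n k) x)) \<longlonglongrightarrow> 0"
    and time: "\<And>k. n1 f ((inv f ^^ n k) x) (\<rho> (j k) ((inv f ^^ n k) x)) \<gamma>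
                 \<in> {n k <.. n k + m \<gamma>}"
    and lim: "hausdorff_limit
       (\<lambda>k. (f ^^ n k) ` closure (ball ((inv f ^^ n k) x) (\<rho> (j k) ((inv f ^^ n k) x)))) C"
    using assms(14) unfolding Fu_def by blast
  define y where "y k = (inv f ^^ n k) x" for k
  define s where "s k = \<rho> (j k) (y k)" for k
  define A where "A k = (f ^^ n k) ` closure (ball (y k) (s k))" for k
  have "\<forall>\<^sub>F k in sequentially. s k < \<gamma>"
    using radii \<open>0 < \<gamma>\<close> unfolding s_def y_def by (rule order_tendstoD(2))
  moreover have "\<forall>\<^sub>F k in sequentially. \<forall>l\<in>{0..2 * m \<gamma>}. diameter ((f ^^ l) ` A k) < \<epsilon>"
    using lim small ucont unfolding A_def s_def y_def
    by (intro eventually_ball_finite ballI hausdorff_limit_diameter_less) auto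
  ultimately have "\<forall>\<^sub>F k in sequentially.
      s k < \<gamma> \<and> (\<forall>l\<in>{0..2 * m \<gamma>}. diameter ((f ^^ l) ` A k) < \<epsilon>)"
    by (rule eventually_conj)
  from eventually_happens'[OF sequentially_bot this] obtain k where "s k < \<gamma>"
    and A_small: "\<And>l. l \<in> {0..2 * m \<gamma>} \<Longrightarrow> diameter ((f ^^ l) ` A k) < \<epsilon>"
    by auto
  have "s k > 0"
    using assms(11) j[of k] by (simp add: first_time_data_def s_def)
  define N where "N = n1 f (y k) (s k) \<epsilon>"
  have growth: "diameter ((f ^^ N) ` ball (y k) (s k)) > \<epsilon>"
    unfolding N_def using bdd sens \<open>\<epsilon> \<le> c\<close> \<open>s k > 0\<close> by (rule n1_diameter)
  have "n1 f (y k) (s k) \<gamma> \<in> {n k <.. n k + m \<gamma>}"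
    using time[of k] by (simp add: s_def y_def)
  moreover have "n1 f (y k) (s k) \<gamma> \<le> N"
    unfolding N_def using bdd sens \<open>\<epsilon> \<le> c\<close> \<open>s k > 0\<close> \<open>\<gamma> \<le> \<epsilon>\<close> by (rule n1_mono)
  moreover have "\<bar>real (n1 f (y k) (s k) \<gamma>) - real N\<bar> \<le> real (m \<gamma>)"
    using assms(11) \<open>0 < \<gamma>\<close> \<open>\<gamma> \<le> \<epsilon>\<close> j[of k] \<open>s k < \<gamma>\<close>
    unfolding first_time_data_def N_def s_def by simp
  ultimately have N: "n k \<le> N" "N - n k \<in> {0..2 * m \<gamma>}"
    by auto
  have "(f ^^ N) ` ball (y k) (s k) \<subseteq> (f ^^ N) ` closure (ball (y k) (s k))"
    by (intro image_mono closure_subset)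
  also have "\<dots> = (f ^^ (N - n k + n k)) ` closure (ball (y k) (s k))"
    using N(1) by simp
  also have "\<dots> = (f ^^ (N - n k)) ` A k"
    by (simp only: A_def image_comp funpow_add)
  finally have "diameter ((f ^^ N) ` ball (y k) (s k)) \<le> diameter ((f ^^ (N - n k)) ` A k)"
    by (intro diameter_subset bounded_subset[OF bdd]) auto
  with growth A_small[OF N(2)] show False
    by linarith
qed

end
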